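(* Let $B>0$ and suppose that every $\ell_{t,i}$ ($1\le t\le T$, $1\le i\le n$) is a convex function from $\Theta$ to $[0,B]$. Let $\Lambda=[1/n,1]$, and for $\eta\in\Lambda$ let $$\mathcal{L}_t(\eta) = \min_{\theta\in\Theta_0} \sum_{i=1}^n \ell_{t,i}(\theta)+ \frac{\eta n \left[\max_{\vartheta\in\Theta_0,1\leq i\leq n}\ell_{t,i}(\vartheta)\right]^2 }{8} + \frac{\log M}{\eta}.$$ Let $\eta_1=1$, $L=n^2\log(M)+nB^2/8$ and $\alpha=\frac{1}{L}\sqrt{\frac{2}{T}}$, and let $\eta_2,\dots,\eta_T$ be produced by OGMS or OPMS applied to the functions $\mathcal{L}_t$ with step $\alpha$ and starting point $\eta_1$. If, for each $t$, EWA with uniform prior on $\Theta_0$ and learning rate $\eta_t$ is used within task $t$, then $$\sum_{t=1}^T \sum_{i=1}^n \ell_{t,i}(\theta_{t,i}^{\eta_t}) \leq \sum_{t=1}^T \min_{\theta\in\Theta_0} \sum_{i=1}^n \ell_{t,i}(\theta)+ b T \sqrt{\frac{n \log(M)}{2}}+ T\log(M)+ \frac{b^2 T }{8}+ \left(n^2\log M + \frac{nB^2}{8} \right)\sqrt{2T},$$ where $b = \max_{\theta\in\Theta_0,1\leq t\leq T,1\leq i\leq n}|\ell_{t,i}(\theta)|$.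
   Context: $T,n,M\ge1$ are integers, $\Theta_0=\{\theta_1,\dots,\theta_M\}\subset\mathbb{R}^d$ is a finite set of $M$ points, and $\Theta=\mathrm{conv}(\theta_1,\dots,\theta_M)$ is its convex hull. Tasks $t=1,\dots,T$ each have $n$ rounds with losses $\ell_{t,1},\dots,\ell_{t,n}$. EWA (exponentially weighted aggregation) with prior $\pi$ on $\Theta_0$ and learning rate $\eta>0$ plays, at round $i$ of task $t$, $\theta_{t,i}=\sum_{\theta\in\Theta_0}p_{t,i}(\theta)\,\theta$ with $$p_{t,i}(\theta)=\frac{\exp\left[-\eta\sum_{j=1}^{i-1}\ell_{t,j}(\theta)\right]\pi(\theta)}{\sum_{\vartheta\in\Theta_0}\exp\left[-\eta\sum_{j=1}^{i-1}\ell_{t,j}(\vartheta)\right]\pi(\vartheta)}.$$ Here $\pi(\theta)=1/M$ for all $\theta\in\Theta_0$, and $\theta_{t,i}^{\eta}$ denotes the resulting decision with learning rate $\eta$. OGMS with step $\alpha$ and starting point $\eta_1$: for $t>1$, $\eta_t$ is the projection on $[1/n,1]$ of $\eta_{t-1}-\alpha\mathcal{L}_{t-1}'(\eta_{t-1})$, that is, of $$\eta_{t-1}-\alpha\left(\frac{n\left[\max_{\theta\in\Theta_0,1\le i\le n}\ell_{t-1,i}(\theta)\right]^2}{8}-\frac{\log M}{\eta_{t-1}^2}\right).$$ OPMS with step $\alpha$ and starting point $\eta_1$: for $t>1$, $\eta_t=\operatorname{argmin}_{\eta\in[1/n,1]}\big\{\mathcal{L}_{t-1}(\eta)+\frac{(\eta-\eta_{t-1})^2}{2\alpha}\big\}$.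 *)

theory Defs
  imports "HOL-Analysis.Analysis"
begin

text \<open>A task is given by its losses \<open>f i\<close>, indexed by rounds \<open>i = 1, \<dots>, n\<close>. The losses are total
  functions; only their values on the convex hull of \<open>\<Theta>0\<close> matter.\<close>

definition ewa_weight ::
    "'a set \<Rightarrow> ('a \<Rightarrow> real) \<Rightarrow> real \<Rightarrow> (nat \<Rightarrow> 'a \<Rightarrow> real) \<Rightarrow> nat \<Rightarrow> 'a \<Rightarrow> real" where
  "ewa_weight \<Theta>0 \<pi> \<eta> f i \<theta> =
     exp (- \<eta> * (\<Sum>j=1..<i. f j \<theta>)) * \<pi> \<theta> /
     (\<Sum>\<theta>'\<in>\<Theta>0. exp (- \<eta> * (\<Sum>j=1..<i. f j \<theta>')) * \<pi> \<theta>')"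

definition ewa_decision ::
    "'a::real_vector set \<Rightarrow> ('a \<Rightarrow> real) \<Rightarrow> real \<Rightarrow> (nat \<Rightarrow> 'a \<Rightarrow> real) \<Rightarrow> nat \<Rightarrow> 'a" where
  "ewa_decision \<Theta>0 \<pi> \<eta> f i = (\<Sum>\<theta>\<in>\<Theta>0. ewa_weight \<Theta>0 \<pi> \<eta> f i \<theta> *\<^sub>R \<theta>)"

definition uniform_prior :: "'a set \<Rightarrow> 'a \<Rightarrow> real" where
  "uniform_prior \<Theta>0 \<theta> = 1 / real (card \<Theta>0)"

definition meta_loss :: "'a set \<Rightarrow> nat \<Rightarrow> (nat \<Rightarrow> 'a \<Rightarrow> real) \<Rightarrow> real \<Rightarrow> real" where
  "meta_loss \<Theta>0 n f \<eta> =
     Min ((\<lambda>\<theta>. \<Sum>i=1..n. f i \<theta>) ` \<Theta>0)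
     + \<eta> * real n * (Max ((\<lambda>(\<theta>', i). f i \<theta>') ` (\<Theta>0 \<times> {1..n})))\<^sup>2 / 8
     + ln (real (card \<Theta>0)) / \<eta>"

text \<open>The meta-loss is used for \<open>\<eta> \<in> [1/n, 1]\<close>, but the formula makes sense for every \<open>\<eta> > 0\<close>. Hence
  the two-sided derivative at the endpoints (and on the degenerate interval \<open>n = 1\<close>) is the
  usual expression.\<close>

lemma deriv_meta_loss:
  assumes "\<eta> > 0"
  shows "deriv (meta_loss \<Theta>0 n f) \<eta> =
    real n * (Max ((\<lambda>(\<theta>', i). f i \<theta>') ` (\<Theta>0 \<times> {1..n})))\<^sup>2 / 8 - ln (real (card \<Theta>0)) / \<eta>\<^sup>2"
  unfolding meta_loss_def
  by (rule DERIV_imp_deriv)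
    (use assms in \<open>auto intro!: derivative_eq_intros simp: power2_eq_square\<close>)

definition is_OGMS ::
    "real set \<Rightarrow> (nat \<Rightarrow> real \<Rightarrow> real) \<Rightarrow> nat \<Rightarrow> real \<Rightarrow> real \<Rightarrow> (nat \<Rightarrow> real) \<Rightarrow> bool" where
  "is_OGMS \<Lambda> F T \<alpha> start \<eta> \<longleftrightarrow>
     \<eta> 1 = start \<and>
     (\<forall>t\<in>{2..T}. \<eta> t = closest_point \<Lambda> (\<eta> (t - 1) - \<alpha> * deriv (F (t - 1)) (\<eta> (t - 1))))"

definition is_OPMS ::
    "real set \<Rightarrow> (nat \<Rightarrow> real \<Rightarrow> real) \<Rightarrow> nat \<Rightarrow> real \<Rightarrow> real \<Rightarrow> (nat \<Rightarrow> real) \<Rightarrow> bool" where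
  "is_OPMS \<Lambda> F T \<alpha> start \<eta> \<longleftrightarrow>
     \<eta> 1 = start \<and>
     (\<forall>t\<in>{2..T}. is_arg_min (\<lambda>x. F (t - 1) x + (x - \<eta> (t - 1))\<^sup>2 / (2 * \<alpha>)) (\<lambda>x. x \<in> \<Lambda>) (\<eta> t))"

end

theory Submission
  imports Defs "HOL-Probability.Hoeffding"
begin

text \<open>By Hoeffding's lemma, the loss of EWA with rate \<open>\<eta>\<^sub>t\<close> in task \<open>t\<close> is at most the meta-loss of the
  task at \<open>\<eta>\<^sub>t\<close>. The meta-losses are convex and \<open>L\<close>-Lipschitz on \<open>[1/n, 1]\<close>, so gradient and proximal
  steps alike have regret at most \<open>1 / (2 \<alpha>) + \<alpha> L\<^sup>2 T / 2 = 3 L sqrt (2 T) / 4\<close> against every fixed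
  rate. Comparing with a near-optimal fixed rate for losses bounded by \<open>b\<close> gives the bound.\<close>

section \<open>Regret of exponentially weighted aggregation\<close>

text \<open>Convexity puts each \<open>exp (- \<eta> * x s)\<close> below its chord over
  \<open>{0..m}\<close>. Averaging the chords amounts to replacing \<open>x\<close> by a variable
  with values in \<open>{0, m}\<close> and the same mean; \<open>Hoeffdings_lemma_aux\<close> bounds
  the logarithm of its moment generating function.\<close>

lemma hoeffding_lemma_finite:
  fixes p x :: "'a \<Rightarrow> real"
  assumes fin: "finite S" and p_nonneg: "\<And>s. s \<in> S \<Longrightarrow> p s \<ge> 0" and p_sum: "sum p S = 1"
    and x: "\<And>s. s \<in> S \<Longrightarrow> x s \<in> {0..m}" and "\<eta> \<ge> 0"
  shows "(\<Sum>s\<in>S. p s * exp (- \<eta> * x s)) \<le> exp (- \<eta> * (\<Sum>s\<in>S. p s * x s) + (\<eta> * m)\<^sup>2 / 8)"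
proof (cases "m > 0")
  case False
  then have "x s = 0" if "s \<in> S" for s
    using x[OF that] by auto
  then show ?thesis
    using p_sum by simp
next
  case True
  \<comment> \<open>\<open>Hoeffdings_lemma_aux\<close> asks for a nonnegative exponent, so
    \<open>x\<close> is reflected to \<open>m - x\<close>: \<open>q\<close> is the mean of
    \<open>m - x\<close> in units of \<open>m\<close>, and the factor \<open>exp (- h)\<close> below
    undoes the reflection.\<close>
  define h where "h = \<eta> * m"
  define q where "q = (\<Sum>s\<in>S. p s * ((m - x s) / m))"
  have h: "h \<ge> 0"
    using True \<open>\<eta> \<ge> 0\<close> by (simp add: h_def)
  have q: "q \<ge> 0"
    unfolding q_def using x p_nonneg True by (intro sum_nonneg mult_nonneg_nonneg) auto
  have chord: "exp (- \<eta> * x s) \<le> exp (- h) * (1 + (m - x s) / m * (exp h - 1))" if "s \<in> S" for s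
  proof -
    define r where "r = (m - x s) / m"
    have r: "0 \<le> r" "r \<le> 1"
      using x[OF that] True by (auto simp: r_def field_simps)
    have "exp ((1 - r) *\<^sub>R 0 + r *\<^sub>R h) \<le> (1 - r) * exp 0 + r * exp h"
      using exp_convex r by (intro convex_onD) auto
    then have "exp (r * h) \<le> 1 + r * (exp h - 1)"
      by (simp add: algebra_simps)
    moreover have "exp (- \<eta> * x s) = exp (- h) * exp (r * h)"
      using True by (simp add: r_def h_def flip: exp_add) (simp add: field_simps)
    ultimately show ?thesis
      by (simp add: r_def)
  qed
  have "(\<Sum>s\<in>S. p s * exp (- \<eta> * x s))
      \<le> (\<Sum>s\<in>S. p s * (exp (- h) * (1 + (m - x s) / m * (exp h - 1))))"
    by (intro sum_mono mult_left_mono chord p_nonneg)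
  also have "\<dots> = (\<Sum>s\<in>S. exp (- h) * p s + exp (- h) * (exp h - 1) * (p s * ((m - x s) / m)))"
    by (intro sum.cong) (auto simp: algebra_simps)
  also have "\<dots> = exp (- h) * (1 + q * (exp h - 1))"
    unfolding sum.distrib sum_distrib_left[symmetric] q_def[symmetric] p_sum
    by (simp add: algebra_simps)
  also have "\<dots> \<le> exp (- h) * exp (h * q + h\<^sup>2 / 8)"
  proof -
    have "1 + q * (exp h - 1) > 0"
      using q h by (intro add_pos_nonneg) auto
    then have "1 + q * (exp h - 1) = exp (ln (1 + q * (exp h - 1)))"
      by simp
    also have "\<dots> \<le> exp (h * q + h\<^sup>2 / 8)"
      using Hoeffdings_lemma_aux[OF h q] by simp
    finally show ?thesis
      by simp
  qed
  also have "\<dots> = exp (- h + h * q + h\<^sup>2 / 8)"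
    by (simp flip: exp_add)
  also have "h * q = (\<Sum>s\<in>S. \<eta> * m * p s - \<eta> * (p s * x s))"
    unfolding q_def h_def sum_distrib_left
    by (intro sum.cong) (use True in \<open>auto simp: field_simps\<close>)
  also have "\<dots> = h - \<eta> * (\<Sum>s\<in>S. p s * x s)"
    by (simp add: sum_subtractf p_sum h_def flip: sum_distrib_left)
  finally show ?thesis
    by (simp add: h_def)
qed

text \<open>The normalising constant \<open>W i\<close> acts as a potential. Each round multiplies
  it by the weighted mean of \<open>exp (- \<eta> * f i s)\<close>, which Hoeffding's lemma and then
  Jensen's inequality bound in terms of the loss of the averaged decision. At the end it is still at
  least the unnormalised weight of the single point \<open>s\<close>, and logarithms turn the two
  bounds into the regret.\<close>

lemma ewa_regret:
  fixes f :: "nat \<Rightarrow> 'a::real_vector \<Rightarrow> real"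
  assumes fin: "finite S" and prior: "\<And>s. s \<in> S \<Longrightarrow> \<pi> s > 0" "sum \<pi> S = 1"
    and conv: "\<And>i. i \<in> {1..n} \<Longrightarrow> convex_on (convex hull S) (f i)"
    and range: "\<And>i s. i \<in> {1..n} \<Longrightarrow> s \<in> S \<Longrightarrow> f i s \<in> {0..m}"
    and "\<eta> > 0" and "s \<in> S"
  shows "(\<Sum>i=1..n. f i (ewa_decision S \<pi> \<eta> f i))
    \<le> (\<Sum>i=1..n. f i s) + \<eta> * real n * m\<^sup>2 / 8 + ln (1 / \<pi> s) / \<eta>"
proof -
  define W where "W i = (\<Sum>s\<in>S. exp (- \<eta> * (\<Sum>j=1..<i. f j s)) * \<pi> s)" for i
  have ne: "S \<noteq> {}"
    using \<open>s \<in> S\<close> by auto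
  have W_pos: "W i > 0" for i
    unfolding W_def using fin ne prior by (intro sum_pos) auto
  have W_step: "W (Suc i) \<le> W i * exp (- \<eta> * f i (ewa_decision S \<pi> \<eta> f i) + (\<eta> * m)\<^sup>2 / 8)"
    if i: "i \<in> {1..n}" for i
  proof -
    define p where "p = ewa_weight S \<pi> \<eta> f i"
    have p_eq: "p s = exp (- \<eta> * (\<Sum>j=1..<i. f j s)) * \<pi> s / W i" for s
      by (simp add: p_def ewa_weight_def W_def)
    have p_nonneg: "p s \<ge> 0" if "s \<in> S" for s
      unfolding p_eq using W_pos[of i] prior(1)[OF that] by simp
    have p_sum: "sum p S = 1"
      using W_pos[of i] by (simp add: p_eq flip: sum_divide_distrib) (simp add: W_def)
    \<comment> \<open>\<open>W i * p s\<close> is the unnormalised weight before round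
      \<open>i\<close>. Since \<open>i \<ge> 1\<close>, the sum over \<open>{1..<Suc i}\<close>
      gains exactly the term \<open>f i s\<close>.\<close>
    have "W (Suc i) = (\<Sum>s\<in>S. W i * (p s * exp (- \<eta> * f i s)))"
      unfolding W_def[of "Suc i"] p_eq
      using i W_pos[of i] by (intro sum.cong) (auto simp: algebra_simps exp_add exp_diff exp_minus divide_inverse)
    also have "\<dots> = W i * (\<Sum>s\<in>S. p s * exp (- \<eta> * f i s))"
      by (simp add: sum_distrib_left)
    also have "\<dots> \<le> W i * exp (- \<eta> * (\<Sum>s\<in>S. p s * f i s) + (\<eta> * m)\<^sup>2 / 8)"
      using W_pos[of i] range[OF i] \<open>\<eta> > 0\<close>
      by (intro mult_left_mono hoeffding_lemma_finite fin p_nonneg p_sum) auto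
    also have "\<dots> \<le> W i * exp (- \<eta> * f i (ewa_decision S \<pi> \<eta> f i) + (\<eta> * m)\<^sup>2 / 8)"
    proof -
      have "f i (\<Sum>s\<in>S. p s *\<^sub>R s) \<le> (\<Sum>s\<in>S. p s * f i s)"
        using p_nonneg by (intro convex_on_sum[OF fin ne conv[OF i] p_sum]) (auto intro: hull_inc)
      then show ?thesis
        using W_pos[of i] \<open>\<eta> > 0\<close> by (simp add: ewa_decision_def p_def)
    qed
    finally show ?thesis .
  qed
  have W_bound: "W (Suc k) \<le>
      exp (- \<eta> * (\<Sum>i=1..k. f i (ewa_decision S \<pi> \<eta> f i)) + real k * ((\<eta> * m)\<^sup>2 / 8))"
    if "k \<le> n" for k
    using that
  proof (induction k)
    case 0
    then show ?case
      by (simp add: W_def prior)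
  next
    case (Suc k)
    have "W (Suc (Suc k))
        \<le> W (Suc k) * exp (- \<eta> * f (Suc k) (ewa_decision S \<pi> \<eta> f (Suc k)) + (\<eta> * m)\<^sup>2 / 8)"
      using Suc.prems by (intro W_step) auto
    also have "\<dots> \<le> exp (- \<eta> * (\<Sum>i=1..k. f i (ewa_decision S \<pi> \<eta> f i)) + real k * ((\<eta> * m)\<^sup>2 / 8))
        * exp (- \<eta> * f (Suc k) (ewa_decision S \<pi> \<eta> f (Suc k)) + (\<eta> * m)\<^sup>2 / 8)"
      using Suc by (intro mult_right_mono) auto
    also have "\<dots> = exp (- \<eta> * (\<Sum>i=1..Suc k. f i (ewa_decision S \<pi> \<eta> f i))
        + real (Suc k) * ((\<eta> * m)\<^sup>2 / 8))"
      unfolding exp_add[symmetric] by (simp add: algebra_simps)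
    finally show ?case .
  qed
  have "exp (- \<eta> * (\<Sum>j=1..n. f j s)) * \<pi> s \<le> W (Suc n)"
    unfolding W_def using prior(1) fin \<open>s \<in> S\<close>
    by (intro order_trans[OF _ member_le_sum[of s S]])
      (auto simp: atLeastLessThanSuc_atLeastAtMost less_imp_le)
  also note W_bound[OF order_refl]
  finally have "ln (exp (- \<eta> * (\<Sum>j=1..n. f j s)) * \<pi> s)
      \<le> ln (exp (- \<eta> * (\<Sum>i=1..n. f i (ewa_decision S \<pi> \<eta> f i)) + real n * ((\<eta> * m)\<^sup>2 / 8)))"
    using prior(1)[OF \<open>s \<in> S\<close>] by (subst ln_le_cancel_iff) auto
  then have "\<eta> * (\<Sum>i=1..n. f i (ewa_decision S \<pi> \<eta> f i))
      \<le> \<eta> * (\<Sum>j=1..n. f j s) + real n * ((\<eta> * m)\<^sup>2 / 8) + ln (1 / \<pi> s)"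
    using prior(1)[OF \<open>s \<in> S\<close>] by (simp add: ln_mult ln_div)
  then show ?thesis
    using \<open>\<eta> > 0\<close> by (simp add: field_simps power2_eq_square)
qed

section \<open>Online gradient and online proximal steps\<close>

text \<open>Projection onto \<open>S\<close> is nonexpansive and fixes \<open>u\<close>, so the new
  point is no farther from \<open>u\<close> than the unprojected one. Expanding that squared
  distance produces \<open>g * (x - u)\<close>, which \<open>sub\<close> bounds below by
  \<open>F x - F u\<close>.\<close>

lemma gradient_step:
  fixes S :: "real set"
  assumes S: "convex S" "closed S" and u: "u \<in> S" and "\<alpha> > 0" and g: "\<bar>g\<bar> \<le> L"
    and sub: "F x - F u \<le> g * (x - u)"
  shows "F x - F u
    \<le> ((u - x)\<^sup>2 - (u - closest_point S (x - \<alpha> * g))\<^sup>2) / (2 * \<alpha>) + \<alpha> * L\<^sup>2 / 2"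
proof -
  have "dist (closest_point S u) (closest_point S (x - \<alpha> * g)) \<le> dist u (x - \<alpha> * g)"
    using S u by (intro closest_point_lipschitz) auto
  then have "(u - closest_point S (x - \<alpha> * g))\<^sup>2 \<le> (u - (x - \<alpha> * g))\<^sup>2"
    by (simp add: closest_point_self[OF u] dist_real_def abs_le_square_iff)
  also have "\<dots> = (u - x)\<^sup>2 - 2 * \<alpha> * (g * (x - u)) + \<alpha>\<^sup>2 * g\<^sup>2"
    by (simp add: power2_eq_square algebra_simps)
  also have "\<dots> \<le> (u - x)\<^sup>2 - 2 * \<alpha> * (F x - F u) + \<alpha>\<^sup>2 * L\<^sup>2"
    using sub \<open>\<alpha> > 0\<close> abs_le_square_iff[of g L] g by (intro add_mono diff_mono mult_left_mono) auto
  finally show ?thesis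
    using \<open>\<alpha> > 0\<close> by (simp add: field_simps power2_eq_square)
qed

text \<open>Differentiability of \<open>F\<close> is avoided: \<open>z\<close> is compared with
  points \<open>w\<close> on the segment towards \<open>u\<close>, convexity bounds
  \<open>F w\<close>, and after division by \<open>s\<close> the limit
  \<open>s \<rightarrow> 0\<close> removes the remaining quadratic error.\<close>

lemma prox_three_point:
  fixes S :: "real set"
  assumes F: "convex_on S F" and u: "u \<in> S" and "\<alpha> > 0"
    and z: "is_arg_min (\<lambda>y. F y + (y - x)\<^sup>2 / (2 * \<alpha>)) (\<lambda>y. y \<in> S) z"
  shows "F z - F u \<le> ((u - x)\<^sup>2 - (u - z)\<^sup>2 - (z - x)\<^sup>2) / (2 * \<alpha>)"
proof -
  have zS: "z \<in> S"
    using z by (simp add: is_arg_min_def)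
  have S: "convex S"
    using F by (simp add: convex_on_def)
  have bound: "F z - F u \<le> (u - z) * (z - x) / \<alpha> + s * ((u - z)\<^sup>2 / (2 * \<alpha>))"
    if s: "s \<in> {0<..<1}" for s
  proof -
    define w where "w = (1 - s) *\<^sub>R z + s *\<^sub>R u"
    have "w \<in> S"
      unfolding w_def using S zS u s by (intro convexD) auto
    then have "F z + (z - x)\<^sup>2 / (2 * \<alpha>) \<le> F w + (w - x)\<^sup>2 / (2 * \<alpha>)"
      using z by (auto simp: is_arg_min_linorder)
    also have "F w \<le> (1 - s) * F z + s * F u"
      unfolding w_def using F zS u s by (intro convex_onD) auto
    finally have "s * (F z - F u) \<le> ((w - x)\<^sup>2 - (z - x)\<^sup>2) / (2 * \<alpha>)"
      by (simp add: algebra_simps diff_divide_distrib)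
    also have "\<dots> = s * ((u - z) * (z - x) / \<alpha> + s * ((u - z)\<^sup>2 / (2 * \<alpha>)))"
      using \<open>\<alpha> > 0\<close> by (simp add: w_def field_simps power2_eq_square)
    finally show ?thesis
      using s by simp
  qed
  have "((\<lambda>s. (u - z) * (z - x) / \<alpha> + s * ((u - z)\<^sup>2 / (2 * \<alpha>)))
      \<longlongrightarrow> (u - z) * (z - x) / \<alpha> + 0 * ((u - z)\<^sup>2 / (2 * \<alpha>))) (at_right 0)"
    by (intro tendsto_intros)
  moreover have "eventually (\<lambda>s::real. s \<in> {0<..<1}) (at_right 0)"
    by (rule eventually_at_right_real) simp
  ultimately have "F z - F u \<le> (u - z) * (z - x) / \<alpha> + 0 * ((u - z)\<^sup>2 / (2 * \<alpha>))"
    using bound by (intro tendsto_lowerbound[where F = "at_right (0::real)"])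
      (auto elim: eventually_mono)
  \<comment> \<open>Polarisation: \<open>u - x\<close> is the sum of \<open>u - z\<close> and
    \<open>z - x\<close>.\<close>
  also have "\<dots> = ((u - x)\<^sup>2 - (u - z)\<^sup>2 - (z - x)\<^sup>2) / (2 * \<alpha>)"
    using \<open>\<alpha> > 0\<close> by (simp add: field_simps power2_eq_square)
  finally show ?thesis .
qed

lemma linear_le_quadratic:
  fixes L d \<alpha> :: real
  assumes "\<alpha> > 0"
  shows "L * d \<le> d\<^sup>2 / (2 * \<alpha>) + \<alpha> * L\<^sup>2 / 2"
proof -
  have "0 \<le> (d - \<alpha> * L)\<^sup>2 / (2 * \<alpha>)"
    using assms by simp
  also have "\<dots> = d\<^sup>2 / (2 * \<alpha>) + \<alpha> * L\<^sup>2 / 2 - L * d"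
    using assms by (simp add: field_simps power2_eq_square)
  finally show ?thesis
    by simp
qed

text \<open>The three-point inequality controls the loss at the new point \<open>z\<close>, while
  regret is charged at the old point \<open>x\<close>. The Lipschitz bound pays for the move, and
  its quadratic part cancels the term \<open>- (z - x)\<^sup>2\<close>. The result has the same form
  as for a gradient step, so one summation serves both methods.\<close>

lemma prox_step:
  fixes S :: "real set"
  assumes F: "convex_on S F" and u: "u \<in> S" and "\<alpha> > 0"
    and z: "is_arg_min (\<lambda>y. F y + (y - x)\<^sup>2 / (2 * \<alpha>)) (\<lambda>y. y \<in> S) z"
    and lip: "F x - F z \<le> L * \<bar>x - z\<bar>"
  shows "F x - F u \<le> ((u - x)\<^sup>2 - (u - z)\<^sup>2) / (2 * \<alpha>) + \<alpha> * L\<^sup>2 / 2"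
proof -
  have "F x - F z \<le> (z - x)\<^sup>2 / (2 * \<alpha>) + \<alpha> * L\<^sup>2 / 2"
    using lip linear_le_quadratic[OF \<open>\<alpha> > 0\<close>, of L "\<bar>x - z\<bar>"] by (simp add: power2_commute)
  with prox_three_point[OF F u \<open>\<alpha> > 0\<close> z] show ?thesis
    by (simp add: diff_divide_distrib)
qed

text \<open>No iterate follows the last round, so that round is charged by the Lipschitz bound alone.\<close>

lemma online_regret:
  fixes \<eta> :: "nat \<Rightarrow> real"
  assumes "T \<ge> 1" and "\<alpha> > 0"
    and step: "\<And>t. t \<in> {1..<T} \<Longrightarrow>
      F t (\<eta> t) - F t u \<le> ((u - \<eta> t)\<^sup>2 - (u - \<eta> (Suc t))\<^sup>2) / (2 * \<alpha>) + \<alpha> * L\<^sup>2 / 2"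
    and lip: "F T (\<eta> T) - F T u \<le> L * \<bar>\<eta> T - u\<bar>"
  shows "(\<Sum>t=1..T. F t (\<eta> t)) \<le> (\<Sum>t=1..T. F t u) + (u - \<eta> 1)\<^sup>2 / (2 * \<alpha>) + real T * \<alpha> * L\<^sup>2 / 2"
proof -
  have partial: "(\<Sum>t=1..<k. F t (\<eta> t) - F t u)
      \<le> ((u - \<eta> 1)\<^sup>2 - (u - \<eta> k)\<^sup>2) / (2 * \<alpha>) + (real k - 1) * (\<alpha> * L\<^sup>2 / 2)"
    if "1 \<le> k" "k \<le> T" for k
    using that
  proof (induction k rule: dec_induct)
    case base
    then show ?case by simp
  next
    case (step k)
    then show ?case
      using assms(3)[of k] by (simp add: algebra_simps diff_divide_distrib)
  qed
  \<comment> \<open>The quadratic term is exactly what telescoping over the earlier rounds leaves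
    with a negative sign, so the last round costs no more than any other.\<close>
  have "F T (\<eta> T) - F T u \<le> (u - \<eta> T)\<^sup>2 / (2 * \<alpha>) + \<alpha> * L\<^sup>2 / 2"
    using lip linear_le_quadratic[OF \<open>\<alpha> > 0\<close>, of L "\<bar>\<eta> T - u\<bar>"] by (simp add: power2_commute)
  moreover have "(\<Sum>t=1..T. F t (\<eta> t) - F t u)
      = (\<Sum>t=1..<T. F t (\<eta> t) - F t u) + (F T (\<eta> T) - F T u)"
    using \<open>T \<ge> 1\<close> by (simp add: sum.last_plus)
  ultimately have "(\<Sum>t=1..T. F t (\<eta> t) - F t u)
      \<le> (u - \<eta> 1)\<^sup>2 / (2 * \<alpha>) + real T * \<alpha> * L\<^sup>2 / 2"
    using partial[OF \<open>T \<ge> 1\<close> order_refl] by (simp add: algebra_simps diff_divide_distrib)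
  then show ?thesis
    by (simp add: sum_subtractf)
qed

section \<open>The meta-losses\<close>

text \<open>Only the summand \<open>k / \<eta>\<close> is curved, and its gap to the tangent at
  \<open>x\<close> is explicitly \<open>k * (x - u)\<^sup>2 / (x\<^sup>2 * u)\<close>.\<close>

lemma meta_loss_tangent:
  fixes x u :: real
  assumes "x > 0" "u > 0" and "card \<Theta>0 \<ge> 1"
  shows "meta_loss \<Theta>0 n f x - meta_loss \<Theta>0 n f u \<le> deriv (meta_loss \<Theta>0 n f) x * (x - u)"
proof -
  define k where "k = ln (real (card \<Theta>0))"
  have "k \<ge> 0"
    using assms by (simp add: k_def)
  then have "0 \<le> k * (x - u)\<^sup>2 / (x\<^sup>2 * u)"
    using assms by simp
  also have "\<dots> = k / u - k / x - k / x\<^sup>2 * (x - u)"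
    using assms by (simp add: field_simps power2_eq_square)
  finally show ?thesis
    unfolding deriv_meta_loss[OF \<open>x > 0\<close>] unfolding meta_loss_def k_def[symmetric]
    by (simp add: algebra_simps diff_divide_distrib)
qed

lemma convex_on_meta_loss:
  assumes "S \<subseteq> {0<..}" "convex S" and "card \<Theta>0 \<ge> 1"
  shows "convex_on S (meta_loss \<Theta>0 n f)"
proof -
  define a where "a = real n * (Max ((\<lambda>(\<theta>', i). f i \<theta>') ` (\<Theta>0 \<times> {1..n})))\<^sup>2 / 8"
  have lin: "convex_on S (\<lambda>x. a * x)"
    using assms by (intro convex_on_cmul) (auto simp: a_def convex_on_ident)
  have inv: "convex_on S (\<lambda>x. ln (real (card \<Theta>0)) * inverse x)"
    using assms by (intro convex_on_cmul convex_on_inverse) auto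
  have const: "convex_on S (\<lambda>x. Min ((\<lambda>\<theta>. \<Sum>i=1..n. f i \<theta>) ` \<Theta>0))"
    using assms by (simp add: convex_on_const)
  have "meta_loss \<Theta>0 n f = (\<lambda>x. Min ((\<lambda>\<theta>. \<Sum>i=1..n. f i \<theta>) ` \<Theta>0) + a * x
      + ln (real (card \<Theta>0)) * inverse x)"
    by (intro ext) (simp add: meta_loss_def a_def inverse_eq_divide mult_ac)
  with convex_on_add[OF convex_on_add[OF const lin] inv] show ?thesis
    by simp
qed

text \<open>The derivative is a difference of two nonnegative terms. One is at most
  \<open>n * B\<^sup>2 / 8\<close>, the other at most \<open>n\<^sup>2 * k\<close> because
  \<open>1 / x \<le> n\<close>. Their sum is the constant \<open>L\<close> of the theorem.\<close>

lemma abs_deriv_meta_loss_le: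
  assumes "x \<ge> 1 / real n" "n \<ge> 1" "card \<Theta>0 \<ge> 1"
    and "\<bar>Max ((\<lambda>(\<theta>', i). f i \<theta>') ` (\<Theta>0 \<times> {1..n}))\<bar> \<le> B"
  shows "\<bar>deriv (meta_loss \<Theta>0 n f) x\<bar> \<le> (real n)\<^sup>2 * ln (real (card \<Theta>0)) + real n * B\<^sup>2 / 8"
proof -
  define k where "k = ln (real (card \<Theta>0))"
  define m where "m = Max ((\<lambda>(\<theta>', i). f i \<theta>') ` (\<Theta>0 \<times> {1..n}))"
  have k: "k \<ge> 0"
    using assms by (simp add: k_def)
  have "x > 0"
    using assms(1,2) by (auto intro: less_le_trans[rotated])
  have "1 / x \<le> real n"
    using assms \<open>x > 0\<close> by (simp add: field_simps)
  then have "k * (1 / x)\<^sup>2 \<le> k * (real n)\<^sup>2"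
    using k \<open>x > 0\<close> by (intro mult_left_mono power_mono) auto
  moreover have "0 \<le> k * (1 / x)\<^sup>2"
    using k by simp
  moreover have "k * (1 / x)\<^sup>2 = k / x\<^sup>2"
    by (simp add: power_divide)
  moreover have "m\<^sup>2 \<le> B\<^sup>2"
    using assms(4) by (metis abs_ge_zero m_def power2_abs power_mono)
  then have "real n * m\<^sup>2 \<le> real n * B\<^sup>2"
    by (intro mult_left_mono) auto
  moreover have "0 \<le> real n * m\<^sup>2"
    by simp
  ultimately show ?thesis
    unfolding deriv_meta_loss[OF \<open>x > 0\<close>] k_def[symmetric] m_def[symmetric] abs_le_iff
      mult.commute[of _ k] by linarith
qed

text \<open>The witness is the unconstrained minimiser \<open>sqrt (8 k / (n b\<^sup>2))\<close>, clipped to \<open>[1/n, 1]\<close>.\<close>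

lemma learning_rate_tradeoff:
  fixes n b k :: real
  assumes n: "n \<ge> 1" and b: "b \<ge> 0" and k: "k \<ge> 0"
  obtains u where "u \<in> {1 / n..1}" "u * n * b\<^sup>2 / 8 + k / u \<le> b * sqrt (n * k / 2) + k + b\<^sup>2 / 8"
proof -
  \<comment> \<open>The unconstrained minimum is \<open>b * c\<close>, attained where both summands
    equal \<open>b * c / 2\<close>.\<close>
  define c where "c = sqrt (n * k / 2)"
  have c: "c \<ge> 0" "c\<^sup>2 = n * k / 2"
    using n k by (simp_all add: c_def)
  have bc: "b * c \<ge> 0"
    using b c by simp
  have four_c: "(4 * c)\<^sup>2 = n * (8 * k)"
    unfolding power_mult_distrib c(2) by simp
  have nb: "(n * b)\<^sup>2 = n * (n * b\<^sup>2)"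
    by (simp add: power2_eq_square)
  \<comment> \<open>The minimiser lies at or above 1, at or below \<open>1 / n\<close>, or strictly
    between. The first case includes \<open>b = 0\<close>. Clipping to 1 costs at most
    \<open>k\<close>, clipping to \<open>1 / n\<close> at most \<open>b\<^sup>2 / 8\<close>, which
    explains the two extra terms.\<close>
  consider "n * b\<^sup>2 \<le> 8 * k" | "8 * k * n \<le> b\<^sup>2" | "8 * k < n * b\<^sup>2" "b\<^sup>2 < 8 * k * n"
    by (meson not_le)
  then show thesis
  proof cases
    case 1
    have "(n * b)\<^sup>2 \<le> (4 * c)\<^sup>2"
      unfolding four_c nb using 1 n by (intro mult_left_mono) auto
    from power2_le_imp_le[OF this] have "n * b \<le> 4 * c"
      using b c(1) n by simp
    from mult_left_mono[OF this b] have "n * b\<^sup>2 \<le> 4 * (b * c)"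
      by (simp add: power2_eq_square mult_ac)
    then have "1 * n * b\<^sup>2 / 8 + k / 1 \<le> b * c + k + b\<^sup>2 / 8"
      using bc zero_le_power2[of b] by linarith
    with that[of 1] n show thesis
      by (simp add: c_def)
  next
    case 2
    have "(4 * c)\<^sup>2 \<le> b\<^sup>2"
      unfolding four_c using 2 by (simp add: mult_ac)
    from power2_le_imp_le[OF this] have "4 * c \<le> b"
      using b c(1) n by simp
    from mult_left_mono[OF this c(1)] have "4 * c\<^sup>2 \<le> b * c"
      by (simp add: power2_eq_square mult_ac)
    then have "n * k \<le> b * c"
      using c(2) bc by linarith
    then have "1 / n * n * b\<^sup>2 / 8 + k / (1 / n) \<le> b * c + k + b\<^sup>2 / 8"
      using n k by (simp add: mult.commute)
    with that[of "1 / n"] n show thesis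
      by (simp add: c_def)
  next
    case 3
    have "k > 0"
      using 3 k n by (cases "k = 0") auto
    have "b > 0"
      using 3 k b by (cases "b = 0") auto
    define u where "u = 4 * c / (n * b)"
    have cpos: "c > 0"
      using \<open>k > 0\<close> n by (simp add: c_def)
    have "(4 * c)\<^sup>2 \<le> (n * b)\<^sup>2"
      unfolding four_c nb using 3 n by (intro mult_left_mono) auto
    from power2_le_imp_le[OF this] have "4 * c \<le> n * b"
      using b c(1) n by simp
    then have "u \<le> 1"
      using \<open>b > 0\<close> n by (simp add: u_def)
    have "b\<^sup>2 \<le> (4 * c)\<^sup>2"
      unfolding four_c using 3 by (simp add: mult_ac)
    from power2_le_imp_le[OF this] have "b \<le> 4 * c"
      using b c(1) n by simp
    then have "1 / n \<le> u"
      using \<open>b > 0\<close> n by (simp add: u_def field_simps)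
    have "k = 2 * c\<^sup>2 / n"
      using n by (simp add: c(2))
    then have "k / u = b * c / 2"
      using n \<open>b > 0\<close> cpos by (simp add: u_def field_simps power2_eq_square)
    moreover have "u * n * b\<^sup>2 / 8 = b * c / 2"
      using n \<open>b > 0\<close> by (simp add: u_def field_simps power2_eq_square)
    ultimately have "u * n * b\<^sup>2 / 8 + k / u \<le> b * c + k + b\<^sup>2 / 8"
      using k zero_le_power2[of b] by linarith
    with that[of u] \<open>u \<le> 1\<close> \<open>1 / n \<le> u\<close> show thesis
      by (simp add: c_def)
  qed
qed

theorem theorem5p1:
  fixes T n M :: nat
    and \<Theta>0 :: "(real ^ 'd) set"
    and l :: "nat \<Rightarrow> nat \<Rightarrow> real ^ 'd \<Rightarrow> real"
    and B L \<alpha> b :: real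
    and \<Lambda> :: "real set"
    and \<eta> :: "nat \<Rightarrow> real"
  assumes "T \<ge> 1" "n \<ge> 1" "M \<ge> 1"
    and "finite \<Theta>0" "card \<Theta>0 = M"
    and "B > 0"
    and "\<And>t i. t \<in> {1..T} \<Longrightarrow> i \<in> {1..n} \<Longrightarrow> convex_on (convex hull \<Theta>0) (l t i)"
    and "\<And>t i. t \<in> {1..T} \<Longrightarrow> i \<in> {1..n} \<Longrightarrow> l t i \<in> convex hull \<Theta>0 \<rightarrow> {0..B}"
    and "\<Lambda> = {1 / real n..1}"
    and "L = (real n)\<^sup>2 * ln (real M) + real n * B\<^sup>2 / 8"
    and "\<alpha> = (1 / L) * sqrt (2 / real T)"
    and "is_OGMS \<Lambda> (\<lambda>t. meta_loss \<Theta>0 n (l t)) T \<alpha> 1 \<eta> \<or>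
         is_OPMS \<Lambda> (\<lambda>t. meta_loss \<Theta>0 n (l t)) T \<alpha> 1 \<eta>"
    and "b = Max ((\<lambda>(\<theta>, t, i). \<bar>l t i \<theta>\<bar>) ` (\<Theta>0 \<times> {1..T} \<times> {1..n}))"
  shows "(\<Sum>t=1..T. \<Sum>i=1..n. l t i (ewa_decision \<Theta>0 (uniform_prior \<Theta>0) (\<eta> t) (l t) i))
    \<le> (\<Sum>t=1..T. Min ((\<lambda>\<theta>. \<Sum>i=1..n. l t i \<theta>) ` \<Theta>0))
      + b * real T * sqrt (real n * ln (real M) / 2)
      + real T * ln (real M)
      + b\<^sup>2 * real T / 8
      + ((real n)\<^sup>2 * ln (real M) + real n * B\<^sup>2 / 8) * sqrt (2 * real T)"
proof -

  \<comment> \<open>Bounds on the losses and their per-task maxima\<close>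
  note T = assms(1) and n = assms(2) and fin = assms(4) and card = assms(5)
  note conv = assms(7) and range = assms(8)
  define F where "F t = meta_loss \<Theta>0 n (l t)" for t
  define m where "m t = Max ((\<lambda>(\<theta>', i). l t i \<theta>') ` (\<Theta>0 \<times> {1..n}))" for t
  define best where "best t = Min ((\<lambda>\<theta>. \<Sum>i=1..n. l t i \<theta>) ` \<Theta>0)" for t
  define k where "k = ln (real M)"
  have ne: "\<Theta>0 \<noteq> {}"
    using card assms(3) by auto
  have card_ge: "card \<Theta>0 \<ge> 1"
    using card assms(3) by simp
  have k: "k \<ge> 0"
    using assms(3) by (simp add: k_def)
  have l_range: "l t i \<theta> \<in> {0..B}" if "t \<in> {1..T}" "i \<in> {1..n}" "\<theta> \<in> \<Theta>0" for t i \<theta>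
    using range[OF that(1,2)] hull_inc[OF that(3)] by auto
  have l_le_m: "l t i \<theta> \<le> m t" if "i \<in> {1..n}" "\<theta> \<in> \<Theta>0" for t i \<theta>
    unfolding m_def using that fin by (intro Max_ge) force+
  have l_le_b: "l t i \<theta> \<le> b" if "t \<in> {1..T}" "i \<in> {1..n}" "\<theta> \<in> \<Theta>0" for t i \<theta>
  proof -
    have "\<bar>l t i \<theta>\<bar> \<le> b"
      unfolding assms(13) using that fin by (intro Max_ge) force+
    then show ?thesis
      by simp
  qed
  have m_attained: "\<exists>i\<in>{1..n}. \<exists>\<theta>\<in>\<Theta>0. m t = l t i \<theta>" for t
  proof -
    have "m t \<in> (\<lambda>(\<theta>', i). l t i \<theta>') ` (\<Theta>0 \<times> {1..n})"
      unfolding m_def using fin ne n by (intro Max_in) auto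
    then show ?thesis
      by auto
  qed
  have m: "0 \<le> m t" "m t \<le> b" "m t \<le> B" if t: "t \<in> {1..T}" for t
  proof -
    obtain i \<theta> where i: "i \<in> {1..n}" "\<theta> \<in> \<Theta>0" "m t = l t i \<theta>"
      using m_attained by blast
    show "0 \<le> m t" "m t \<le> b" "m t \<le> B"
      using l_range[OF t i(1,2)] l_le_b[OF t i(1,2)] i(3) by simp_all
  qed
  have b: "b \<ge> 0"
    using m(1,2)[of 1] T by simp
  have F_eq: "F t x = best t + x * real n * (m t)\<^sup>2 / 8 + k / x" for t x
    by (simp add: F_def meta_loss_def best_def m_def k_def card)

  \<comment> \<open>Regularity of the meta-losses and the inequality for one step\<close>
  have L: "L > 0"
    \<comment> \<open>For \<open>M = 1\<close> the logarithm vanishes, so positivity comes from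
      \<open>B > 0\<close>.\<close>
    unfolding assms(10) using n \<open>B > 0\<close> k by (intro add_nonneg_pos) (auto simp: k_def)
  have \<alpha>: "\<alpha> > 0"
    using L T by (simp add: assms(11))
  have \<Lambda>: "convex \<Lambda>" "closed \<Lambda>" "\<Lambda> \<noteq> {}" "\<Lambda> \<subseteq> {0<..}" "1 \<in> \<Lambda>"
    using n by (auto simp: assms(9) intro: less_le_trans[rotated])
  have F_tangent: "F t x - F t u \<le> deriv (F t) x * (x - u)" if "x \<in> \<Lambda>" "u \<in> \<Lambda>" for t x u
    unfolding F_def using that \<Lambda>(4) card_ge by (intro meta_loss_tangent) auto
  have F_deriv: "\<bar>deriv (F t) x\<bar> \<le> L" if "t \<in> {1..T}" "x \<in> \<Lambda>" for t x
    unfolding F_def assms(10) card[symmetric]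
    by (rule abs_deriv_meta_loss_le)
      (use that n card_ge m[OF that(1)] assms(9) in \<open>auto simp: m_def\<close>)
  \<comment> \<open>The tangent inequality replaces the mean value theorem here: a derivative bound
    at \<open>x\<close> alone suffices.\<close>
  have F_lip: "F t x - F t u \<le> L * \<bar>x - u\<bar>" if "t \<in> {1..T}" "x \<in> \<Lambda>" "u \<in> \<Lambda>" for t x u
  proof -
    have "deriv (F t) x * (x - u) \<le> \<bar>deriv (F t) x\<bar> * \<bar>x - u\<bar>"
      by (metis abs_ge_self abs_mult)
    also have "\<dots> \<le> L * \<bar>x - u\<bar>"
      using F_deriv[OF that(1,2)] by (intro mult_right_mono) auto
    finally show ?thesis
      using F_tangent[OF that(2,3), of t] by linarith
  qed
  have \<eta>1: "\<eta> 1 = 1"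
    using assms(12) by (auto simp: is_OGMS_def is_OPMS_def)
  have \<eta>: "\<eta> t \<in> \<Lambda>" if "t \<in> {1..T}" for t
  proof (cases "t = 1")
    case True
    then show ?thesis
      using \<eta>1 \<Lambda>(5) by simp
  next
    case False
    then have "t \<in> {2..T}"
      using that by auto
    then show ?thesis
      using assms(12) closest_point_in_set[OF \<Lambda>(2,3)]
      by (auto simp: is_OGMS_def is_OPMS_def is_arg_min_def)
  qed
  have step: "F t (\<eta> t) - F t u \<le> ((u - \<eta> t)\<^sup>2 - (u - \<eta> (Suc t))\<^sup>2) / (2 * \<alpha>) + \<alpha> * L\<^sup>2 / 2"
    if t: "t \<in> {1..<T}" and u: "u \<in> \<Lambda>" for t u
  proof -
    have t': "t \<in> {1..T}" "Suc t \<in> {1..T}" "Suc t \<in> {2..T}"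
      using t by auto
    from assms(12) show ?thesis
    proof
      assume "is_OGMS \<Lambda> (\<lambda>t. meta_loss \<Theta>0 n (l t)) T \<alpha> 1 \<eta>"
      then have "\<eta> (Suc t) = closest_point \<Lambda> (\<eta> t - \<alpha> * deriv (F t) (\<eta> t))"
        using t'(3) by (auto simp: is_OGMS_def F_def dest!: bspec[where x = "Suc t"])
      then show ?thesis
        using gradient_step[OF \<Lambda>(1,2) u \<alpha> F_deriv[OF t'(1) \<eta>[OF t'(1)]]
            F_tangent[OF \<eta>[OF t'(1)] u]] by simp
    next
      assume "is_OPMS \<Lambda> (\<lambda>t. meta_loss \<Theta>0 n (l t)) T \<alpha> 1 \<eta>"
      then have "is_arg_min (\<lambda>x. F t x + (x - \<eta> t)\<^sup>2 / (2 * \<alpha>)) (\<lambda>x. x \<in> \<Lambda>) (\<eta> (Suc t))"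
        using t'(3) by (auto simp: is_OPMS_def F_def dest!: bspec[where x = "Suc t"])
      moreover have "convex_on \<Lambda> (F t)"
        unfolding F_def using \<Lambda> card_ge by (intro convex_on_meta_loss)
      ultimately show ?thesis
        using u \<alpha> F_lip[OF t'(1) \<eta>[OF t'(1)] \<eta>[OF t'(2)]] by (intro prox_step)
    qed
  qed

  \<comment> \<open>Comparison with a fixed learning rate and summation over tasks\<close>
  obtain u where u: "u \<in> \<Lambda>"
    and u_le: "u * real n * b\<^sup>2 / 8 + k / u \<le> b * sqrt (real n * k / 2) + k + b\<^sup>2 / 8"
    using learning_rate_tradeoff[of "real n" b k] n b k unfolding assms(9) by auto
  have ewa: "(\<Sum>i=1..n. l t i (ewa_decision \<Theta>0 (uniform_prior \<Theta>0) (\<eta> t) (l t) i)) \<le> F t (\<eta> t)"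
    if t: "t \<in> {1..T}" for t
  proof -
    have "best t \<in> (\<lambda>\<theta>. \<Sum>i=1..n. l t i \<theta>) ` \<Theta>0"
      unfolding best_def using fin ne by (intro Min_in) auto
    then obtain \<theta> where \<theta>: "\<theta> \<in> \<Theta>0" "best t = (\<Sum>i=1..n. l t i \<theta>)"
      by auto
    have prior: "sum (uniform_prior \<Theta>0) \<Theta>0 = 1" "\<And>\<theta>. uniform_prior \<Theta>0 \<theta> > 0"
      using card_ge by (simp_all add: uniform_prior_def)
    \<comment> \<open>With the best point of the task as comparator, the task's own maximum
      \<open>m t\<close> as range and \<open>ln (1 / (1 / M)) = ln M\<close> as prior cost, the EWA
      bound is exactly the meta-loss at \<open>\<eta> t\<close>.\<close>
    have "(\<Sum>i=1..n. l t i (ewa_decision \<Theta>0 (uniform_prior \<Theta>0) (\<eta> t) (l t) i))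
        \<le> (\<Sum>i=1..n. l t i \<theta>) + \<eta> t * real n * (m t)\<^sup>2 / 8 + ln (1 / uniform_prior \<Theta>0 \<theta>) / \<eta> t"
    proof (rule ewa_regret)
      show "l t i s \<in> {0..m t}" if "i \<in> {1..n}" "s \<in> \<Theta>0" for i s
        using l_range[OF t that] l_le_m[OF that] by simp
    qed (use t fin prior conv \<eta>[OF t] \<Lambda>(4) \<theta>(1) in auto)
    then show ?thesis
      by (simp add: F_eq \<theta>(2) k_def uniform_prior_def card)
  qed
  \<comment> \<open>\<open>u\<close> was tuned for the global bound \<open>b\<close>, so the same
    rate works in every task once \<open>m t\<close> is enlarged to \<open>b\<close>.\<close>
  have comparator: "F t u \<le> best t + (b * sqrt (real n * k / 2) + k + b\<^sup>2 / 8)" if t: "t \<in> {1..T}" for t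
  proof -
    have "u * real n * (m t)\<^sup>2 / 8 \<le> u * real n * b\<^sup>2 / 8"
      using u \<Lambda>(4) m[OF t] by (intro divide_right_mono mult_left_mono power_mono) auto
    then show ?thesis
      unfolding F_eq using u_le by linarith
  qed
  have overhead: "(u - \<eta> 1)\<^sup>2 / (2 * \<alpha>) + real T * \<alpha> * L\<^sup>2 / 2 \<le> L * sqrt (2 * real T)"
  proof -
    define r where "r = sqrt (2 * real T)"
    have r: "r > 0" "r\<^sup>2 = 2 * real T"
      using T by (simp_all add: r_def)
    have "sqrt (2 / real T) * r = 2"
      using T by (simp add: r_def flip: real_sqrt_mult)
    \<comment> \<open>In terms of \<open>r\<close> the two costs are commensurable: at most
      \<open>L * r / 4\<close> for the initial distance and \<open>L * r / 2\<close> for the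
      steps.\<close>
    then have \<alpha>_eq: "\<alpha> = 2 / (L * r)"
      using r(1) L by (simp add: assms(11) field_simps)
    have "\<bar>u - 1\<bar> \<le> 1"
      using u \<Lambda>(4) by (auto simp: assms(9))
    then have "(u - 1)\<^sup>2 \<le> 1"
      by (simp add: abs_square_le_1)
    then have "(u - \<eta> 1)\<^sup>2 / (2 * \<alpha>) \<le> 1 / (2 * \<alpha>)"
      using \<alpha> \<eta>1 by (intro divide_right_mono) auto
    also have "\<dots> = L * r / 4"
      by (simp add: \<alpha>_eq)
    finally have "(u - \<eta> 1)\<^sup>2 / (2 * \<alpha>) \<le> L * r / 4" .
    moreover have "real T * \<alpha> * L\<^sup>2 / 2 = L * r / 2"
      using r L by (simp add: \<alpha>_eq field_simps power2_eq_square)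
    moreover have "L * r \<ge> 0"
      using L r(1) by simp
    ultimately show ?thesis
      unfolding r_def by linarith
  qed
  have "(\<Sum>t=1..T. \<Sum>i=1..n. l t i (ewa_decision \<Theta>0 (uniform_prior \<Theta>0) (\<eta> t) (l t) i))
      \<le> (\<Sum>t=1..T. F t (\<eta> t))"
    by (intro sum_mono ewa)
  also have "\<dots> \<le> (\<Sum>t=1..T. F t u) + (u - \<eta> 1)\<^sup>2 / (2 * \<alpha>) + real T * \<alpha> * L\<^sup>2 / 2"
    using T \<alpha> step u F_lip \<eta> by (intro online_regret) auto
  also have "\<dots> \<le> (\<Sum>t=1..T. F t u) + L * sqrt (2 * real T)"
    using overhead by linarith
  also have "(\<Sum>t=1..T. F t u) \<le> (\<Sum>t=1..T. best t + (b * sqrt (real n * k / 2) + k + b\<^sup>2 / 8))"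
    by (intro sum_mono comparator)
  also have "\<dots> = (\<Sum>t=1..T. best t) + real T * (b * sqrt (real n * k / 2) + k + b\<^sup>2 / 8)"
    by (simp add: sum.distrib)
  finally show ?thesis
    unfolding best_def k_def assms(10) by (simp add: algebra_simps)
qed

end
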